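(* Consider the closed-loop system formed by the partially observed linear-Gaussian plant and the switching control strategy described in the context, where the fallback controller satisfies the stability assumption in the context and the primary controller (the matrices $A_1,B_1,L_1,K_1$) is arbitrary. Let $P_0\succ 0$ be the solution of $$\mathcal{A}_0^\top P_0\mathcal{A}_0-P_0+\begin{bmatrix} Q & 0 \\ 0 & K_0^\top RK_0+I \end{bmatrix}=0,$$ and let $0<\rho_0<1$ be such that $\mathcal{A}_0^\top P_0\mathcal{A}_0\prec\rho_0P_0$. Then for any controller parameters $M,t$ (switching threshold and dwell time), the LQ cost $J$ under the switching strategy satisfies $$J\le\left(\frac{8(1+\rho_0)\left\|\begin{bmatrix} B \\ B_0 \end{bmatrix}\right\|^2\|P_0\|}{(1-\rho_0)^2}+2\|R\|\right)M^2+\frac{8(1+\rho_0)\,\mathrm{tr}\left(\begin{bmatrix} W & 0 \\ 0 & L_0VL_0^\top \end{bmatrix}P_0\right)}{(1-\rho_0)^2}.$$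
   Context: $\|\cdot\|$ is the Euclidean norm of vectors and the induced 2-norm of matrices; a square matrix is stable if its spectral radius is $<1$; $X\prec Y$ means $Y-X$ is positive definite. Plant: for $k\in\mathbb{N}=\{0,1,\dots\}$, $x(k+1)=Ax(k)+Bu(k)+w(k)$, $y(k)=Cx(k)+v(k)$, with $x(k)\in\mathbb{R}^n$, $u(k)\in\mathbb{R}^m$, $y(k)\in\mathbb{R}^p$, where $w(k)\sim\mathcal{N}(0,W)$ i.i.d., $v(k)\sim\mathcal{N}(0,V)$ i.i.d., the two noise sequences are mutually independent, $W\succ0$, $V\succ0$. $(A,B)$ is controllable and $(A,C)$ is observable. LQ cost: $J=\limsup_{T\to\infty}\frac1T\mathbb{E}\left[\sum_{k=0}^{T-1}x(k)^\top Qx(k)+u(k)^\top Ru(k)\right]$ with fixed weight matrices $Q\succ0$ ($n\times n$), $R\succ0$ ($m\times m$). Primary controller: $z_1(k+1)=A_1z_1(k)+B_1u(k)+L_1y(k)$, $u_1(k)=K_1z_1(k)$, $z_1(k)\in\mathbb{R}^{n_1}$. Fallback controller: $z_0(k+1)=A_0z_0(k)+B_0u(k)+L_0y(k)$, $u_0(k)=K_0z_0(k)$, $z_0(k)\in\mathbb{R}^{n_0}$. In both updates $u(k)$ is the input actually applied to the plant. Stability assumption on the fallback controller: the matrices $\mathcal{A}_0=\begin{bmatrix} A & BK_0 \\ L_0C & A_0+B_0K_0 \end{bmatrix}$ and $A_0$ are both stable. Switching strategy with threshold $M>0$ and dwell time $t\in\{1,2,\dots\}$: initialize a counter $\xi(0)=0$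 and $z_0(0)=0$, $z_1(0)=0$. At each $k=0,1,\dots$: compute $u_1(k),u_0(k)$. If $\xi(k)>0$, apply $u(k)=u_0(k)$. If $\xi(k)=0$ and $\|u_1(k)-u_0(k)\|\ge M$, reset $\xi(k)$ to $t$ and apply $u(k)=u_0(k)$. If $\xi(k)=0$ and $\|u_1(k)-u_0(k)\|<M$, apply $u(k)=u_1(k)$. Then update $z_1(k+1),z_0(k+1)$ using $u(k)$, and set $\xi(k+1)=\max\{\xi(k)-1,0\}$. (Thus each triggering makes the strategy use $u_0$ for $t$ consecutive steps.) *)

theory Defs
  imports "HOL-Probability.Probability"
begin

definition block4 ::
  "'a^'c^'r \<Rightarrow> 'a^'d^'r \<Rightarrow> 'a^'c^'s \<Rightarrow> 'a^'d^'s \<Rightarrow> 'a^('c::finite + 'd::finite)^('r::finite + 's::finite)"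
where
  "block4 E F G H = (\<chi> i j.
     case i of
       Inl r \<Rightarrow> (case j of Inl c \<Rightarrow> E $ r $ c | Inr d \<Rightarrow> F $ r $ d)
     | Inr s \<Rightarrow> (case j of Inl c \<Rightarrow> G $ s $ c | Inr d \<Rightarrow> H $ s $ d))"

definition block_col :: "'a^'c^'r \<Rightarrow> 'a^'c^'s \<Rightarrow> 'a^'c^('r::finite + 's::finite)" where
  "block_col E F = (\<chi> i. case i of Inl r \<Rightarrow> E $ r | Inr s \<Rightarrow> F $ s)"

(* The instance norm on matrices is the Frobenius norm, so the induced 2-norm is taken via onorm. *)
definition norm2 :: "real^'c^'r \<Rightarrow> real" where
  "norm2 E = onorm (\<lambda>x. E *v x)"

definition pos_def :: "real^'n^'n \<Rightarrow> bool" where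
  "pos_def X \<longleftrightarrow> transpose X = X \<and> (\<forall>x. x \<noteq> 0 \<longrightarrow> 0 < x \<bullet> (X *v x))"

definition mat_less :: "real^'n^'n \<Rightarrow> real^'n^'n \<Rightarrow> bool" where
  "mat_less X Y \<longleftrightarrow> pos_def (Y - X)"

definition complex_eigenvalue :: "real^'n^'n \<Rightarrow> complex \<Rightarrow> bool" where
  "complex_eigenvalue X l \<longleftrightarrow>
     (\<exists>z :: complex^'n. z \<noteq> 0 \<and> (\<chi> i j. complex_of_real (X $ i $ j)) *v z = l *s z)"

definition spectral_radius :: "real^'n^'n \<Rightarrow> real" where
  "spectral_radius X = Max {cmod l | l. complex_eigenvalue X l}"

definition stable :: "real^'n^'n \<Rightarrow> bool" where
  "stable X \<longleftrightarrow> spectral_radius X < 1"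

(* In discrete time, steering every state to the origin alone would be a weaker notion. *)
definition controllable :: "real^'n^'n \<Rightarrow> real^'m^'n \<Rightarrow> bool" where
  "controllable A B \<longleftrightarrow>
     (\<forall>a b. \<exists>N u s. s 0 = a \<and> s N = b \<and> (\<forall>k<N. s (Suc k) = A *v s k + B *v u k))"

definition observable :: "real^'n^'n \<Rightarrow> real^'n^'p \<Rightarrow> bool" where
  "observable A C \<longleftrightarrow>
     (\<forall>a b. (\<forall>k. C *v (((\<lambda>s. A *v s) ^^ k) a) = C *v (((\<lambda>s. A *v s) ^^ k) b)) \<longrightarrow> a = b)"

(* Lebesgue density of N(0, S), for positive definite S. *)
definition gaussian_density :: "real^'n^'n \<Rightarrow> real^'n \<Rightarrow> real" where
  "gaussian_density S x =
     exp (- (x \<bullet> (matrix_inv S *v x)) / 2) / sqrt ((2 * pi) ^ CARD('n) * det S)"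

(* The library's indep_var requires both random variables to take values in the same type. *)
definition indep_rv ::
  "'a measure \<Rightarrow> 'b measure \<Rightarrow> ('a \<Rightarrow> 'b) \<Rightarrow> 'c measure \<Rightarrow> ('a \<Rightarrow> 'c) \<Rightarrow> bool"
where
  "indep_rv Pr S X T Y \<longleftrightarrow>
     X \<in> measurable Pr S \<and> Y \<in> measurable Pr T \<and>
     prob_space.indep_set Pr {X -` E \<inter> space Pr | E. E \<in> sets S} {Y -` E \<inter> space Pr | E. E \<in> sets T}"

definition iid_gaussian :: "'a measure \<Rightarrow> (nat \<Rightarrow> 'a \<Rightarrow> real^'n) \<Rightarrow> real^'n^'n \<Rightarrow> bool" where
  "iid_gaussian Pr w S \<longleftrightarrow>
     (\<forall>k. distributed Pr lborel (w k) (\<lambda>x. ennreal (gaussian_density S x))) \<and>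
     prob_space.indep_vars Pr (\<lambda>_. borel) w UNIV"

(* The expectation is a nonnegative integral, so that it is infinite, rather than 0 as with the
   Bochner integral, when the cost is not integrable. Intended for Q and R positive semidefinite. *)
definition lq_cost ::
  "'a measure \<Rightarrow> real^'n^'n \<Rightarrow> real^'m^'m \<Rightarrow> (nat \<Rightarrow> 'a \<Rightarrow> real^'n) \<Rightarrow> (nat \<Rightarrow> 'a \<Rightarrow> real^'m) \<Rightarrow> ereal"
where
  "lq_cost Pr Q R x u = limsup (\<lambda>T.
     enn2ereal (\<integral>\<^sup>+\<omega>. ennreal (\<Sum>k<T. x k \<omega> \<bullet> (Q *v x k \<omega>) + u k \<omega> \<bullet> (R *v u k \<omega>)) \<partial>Pr)
       / ereal (real T))"

end

theory Submission
  imports Defs "HOL-Real_Asymp.Real_Asymp"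
begin

text \<open>Under the switching rule the applied input differs from \<open>u0\<close> by less than \<open>M\<close> at every step.
  So the stacked state \<open>s = (x, z0)\<close> obeys \<open>s (k + 1) = AA0 s k + (B; B0) d k + e k\<close> with
  \<open>norm (d k) \<le> M\<close> and \<open>e k = (w k, L0 v k)\<close>. Along every sample path, \<open>V k = s k \<bullet> P0 s k\<close>
  therefore contracts by the factor \<open>(1 + \<rho>0) / 2\<close> up to a multiple of the \<open>P0\<close>-energies of \<open>(B; B0) d k\<close>
  and \<open>e k\<close>, and the Lyapunov equation bounds the stage cost by \<open>2 V k + 2 norm2 R M\<^sup>2\<close>. Summing before
  taking expectations leaves only the mean energy of \<open>e k\<close> to compute, which is the trace term.\<close>

section \<open>Moments of a real random variable from its moment generating function\<close>

text \<open>The step \<open>h\<close> enters the bound only through \<open>h ^ 3\<close>, while the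
  other factor depends on \<open>y\<close> alone. With a random \<open>y\<close> whose exponential
  moments at 2 and -2 are finite, the second-order expansion can therefore be integrated with an
  error of order \<open>h ^ 3\<close>.\<close>

lemma exp_Taylor2_remainder:
  fixes h y :: real
  assumes "0 \<le> h" "h \<le> 1"
  shows "\<bar>exp (h * y) - 1 - h * y - h\<^sup>2 * y\<^sup>2 / 2\<bar> \<le> h ^ 3 * (exp (2 * y) + exp (- 2 * y))"
proof -
  obtain s where s: "\<bar>s\<bar> \<le> \<bar>h * y\<bar>"
    and e: "exp (h * y) = (\<Sum>m<3. ((h * y) ^ m) / fact m) + (exp s / fact 3) * (h * y) ^ 3"
    using Maclaurin_exp_le[of "h * y" 3] by auto
  have "\<bar>h * y\<bar> \<le> \<bar>y\<bar>"
    using assms by (simp add: abs_mult mult_left_le_one_le)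
  then have s': "exp s \<le> exp \<bar>y\<bar>" using s by simp
  \<comment> \<open>The cubic factor is one term of the exponential series, so it is absorbed by a
    second copy of \<open>exp \<bar>y\<bar>\<close>; this is why the exponent in the bound
    doubles.\<close>
  have c: "\<bar>y\<bar> ^ 3 / fact 3 \<le> exp \<bar>y\<bar>"
  proof -
    obtain r where "exp \<bar>y\<bar> = (\<Sum>m<4. \<bar>y\<bar> ^ m / fact m) + (exp r / fact 4) * \<bar>y\<bar> ^ 4"
      using Maclaurin_exp_le[of "\<bar>y\<bar>" 4] by auto
    moreover have "\<bar>y\<bar> ^ 3 / fact 3 \<le> (\<Sum>m<4. \<bar>y\<bar> ^ m / fact m)"
      by (rule member_le_sum) auto
    moreover have "0 \<le> (exp r / fact 4) * \<bar>y\<bar> ^ 4" by simp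
    ultimately show ?thesis by linarith
  qed
  have "exp (h * y) - 1 - h * y - h\<^sup>2 * y\<^sup>2 / 2 = (exp s / fact 3) * (h * y) ^ 3"
    unfolding e by (simp add: numeral_3_eq_3 power2_eq_square algebra_simps)
  also have "\<bar>\<dots>\<bar> = h ^ 3 * (exp s * (\<bar>y\<bar> ^ 3 / fact 3))"
    using assms by (simp add: abs_mult power_mult_distrib power_abs)
  also have "\<dots> \<le> h ^ 3 * (exp \<bar>y\<bar> * exp \<bar>y\<bar>)"
    using assms s' c by (intro mult_left_mono mult_mono) auto
  also have "exp \<bar>y\<bar> * exp \<bar>y\<bar> = exp (2 * \<bar>y\<bar>)"
    by (simp flip: exp_add)
  also have "h ^ 3 * exp (2 * \<bar>y\<bar>) \<le> h ^ 3 * (exp (2 * y) + exp (- 2 * y))"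
    using assms by (intro mult_left_mono) (auto simp: abs_if)
  finally show ?thesis .
qed

text \<open>Integrating the second-order expansion of \<open>exp (h * Y \<omega>)\<close> and
  comparing it with \<open>exp (h\<^sup>2 * s / 2)\<close> as \<open>h\<close> tends to 0 identifies
  the first two moments, in place of differentiating under the integral.\<close>

lemma (in prob_space) moments_of_gaussian_mgf:
  fixes Y :: "'a \<Rightarrow> real"
  assumes [measurable]: "Y \<in> borel_measurable M"
    and mgf: "\<And>h. (\<integral>\<^sup>+\<omega>. ennreal (exp (h * Y \<omega>)) \<partial>M) = ennreal (exp (h\<^sup>2 * s / 2))"
  shows "integrable M Y" "integrable M (\<lambda>\<omega>. (Y \<omega>)\<^sup>2)"
    "expectation Y = 0" "expectation (\<lambda>\<omega>. (Y \<omega>)\<^sup>2) = s"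
proof -
  have ie: "has_bochner_integral M (\<lambda>\<omega>. exp (h * Y \<omega>)) (exp (h\<^sup>2 * s / 2))" for h
    using mgf by (intro has_bochner_integral_nn_integral) auto
  \<comment> \<open>An integrable majorant independent of \<open>h\<close>: it dominates both the
    square of \<open>Y\<close> and, after scaling by \<open>h ^ 3\<close>, the Taylor
    remainder.\<close>
  define G where "G \<omega> = exp (2 * Y \<omega>) + exp (- 2 * Y \<omega>)" for \<omega>
  have iG: "integrable M G"
    unfolding G_def using ie[of 2] ie[of "-2"] by (auto simp: has_bochner_integral_iff)
  have GY: "(Y \<omega>)\<^sup>2 \<le> G \<omega>" for \<omega>
  proof -
    have "exp (2 * Y \<omega>) + exp (- 2 * Y \<omega>) \<ge> (Y \<omega>)\<^sup>2"
    \<comment> \<open>The exponential whose exponent is \<open>2 * \<bar>Y \<omega>\<bar>\<close>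
      already dominates its quadratic Taylor polynomial, which contains
      \<open>2 * (Y \<omega>)\<^sup>2\<close>.\<close>
    proof (cases "Y \<omega> \<ge> 0")
      case True
      then show ?thesis
        using exp_lower_Taylor_quadratic[of "2 * Y \<omega>"] exp_ge_zero[of "- 2 * Y \<omega>"]
        by (simp add: power_mult_distrib) (smt (verit) zero_le_power2 exp_ge_zero)
    next
      case False
      then show ?thesis
        using exp_lower_Taylor_quadratic[of "- 2 * Y \<omega>"] exp_ge_zero[of "2 * Y \<omega>"]
        by (simp add: power_mult_distrib) (smt (verit) zero_le_power2 exp_ge_zero)
    qed
    then show ?thesis by (simp add: G_def)
  qed
  show i2: "integrable M (\<lambda>\<omega>. (Y \<omega>)\<^sup>2)"
    by (rule Bochner_Integration.integrable_bound[OF iG]) (auto intro!: AE_I2 order_trans[OF GY])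
  show i1: "integrable M Y"
    using i2 by (rule square_integrable_imp_integrable[rotated]) simp
  define m1 where "m1 = expectation Y"
  define m2 where "m2 = expectation (\<lambda>\<omega>. (Y \<omega>)\<^sup>2)"
  \<comment> \<open>The sign \<open>k\<close> replaces negative values of \<open>h\<close>, so that
    all limits can be taken from the right.\<close>
  have main: "\<bar>exp (h\<^sup>2 * s / 2) - 1 - k * h * m1 - h\<^sup>2 * m2 / 2\<bar> \<le> h ^ 3 * expectation G"
    if h: "0 < h" "h \<le> 1" and k: "k = 1 \<or> k = - 1" for h k :: real
  proof -
    have kk: "k\<^sup>2 = 1" using k by auto
    have "has_bochner_integral M (\<lambda>\<omega>. exp (h * (k * Y \<omega>)) - 1 - h * (k * Y \<omega>) - h\<^sup>2 * (k * Y \<omega>)\<^sup>2 / 2)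
       (exp (h\<^sup>2 * s / 2) - 1 - k * h * m1 - h\<^sup>2 * m2 / 2)"
      using ie[of "h * k"] i1 i2 kk
      by (simp add: has_bochner_integral_iff m1_def m2_def power_mult_distrib mult_ac prob_space)
    moreover from this have "\<bar>expectation (\<lambda>\<omega>. exp (h * (k * Y \<omega>)) - 1 - h * (k * Y \<omega>) - h\<^sup>2 * (k * Y \<omega>)\<^sup>2 / 2)\<bar>
      \<le> expectation (\<lambda>\<omega>. h ^ 3 * G \<omega>)"
    proof (intro order_trans[OF integral_abs_bound] integral_mono)
      fix \<omega>
      show "\<bar>exp (h * (k * Y \<omega>)) - 1 - h * (k * Y \<omega>) - h\<^sup>2 * (k * Y \<omega>)\<^sup>2 / 2\<bar> \<le> h ^ 3 * G \<omega>"
        using exp_Taylor2_remainder[of h "k * Y \<omega>"] h k by (auto simp: G_def add.commute)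
    qed (simp_all add: iG has_bochner_integral_iff)
    ultimately show ?thesis by (simp add: has_bochner_integral_iff)
  qed
  have b1: "\<bar>m1\<bar> \<le> h\<^sup>2 * expectation G" if h: "0 < h" "h \<le> 1" for h
  proof -
    \<comment> \<open>The two signs give the same even part with opposite linear parts, so the
      triangle inequality isolates the mean.\<close>
    have "h * \<bar>m1\<bar> \<le> h ^ 3 * expectation G"
      using main[OF h, of 1] main[OF h, of "-1"] h by (auto simp: abs_if algebra_simps split: if_splits)
    then have "h * \<bar>m1\<bar> \<le> h * (h\<^sup>2 * expectation G)" by (simp add: eval_nat_numeral)
    then show ?thesis using h by simp
  qed
  have ev: "\<forall>\<^sub>F h in at_right 0. 0 < h \<and> h \<le> (1::real)"
    unfolding eventually_at_right_field by (intro exI[of _ 1]) auto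
  have "\<bar>m1\<bar> \<le> 0"
  proof (rule tendsto_lowerbound)
    show "((\<lambda>h. h\<^sup>2 * expectation G) \<longlongrightarrow> 0) (at_right 0)" by (auto intro!: tendsto_eq_intros)
    show "\<forall>\<^sub>F h in at_right 0. \<bar>m1\<bar> \<le> h\<^sup>2 * expectation G"
      using ev by eventually_elim (use b1 in auto)
  qed simp
  then show m1: "expectation Y = 0" by (simp add: m1_def)
  \<comment> \<open>Once the mean vanishes, division by \<open>h\<^sup>2\<close> still leaves an
    error of order \<open>h\<close>, and the quotient tends to \<open>s / 2\<close>.\<close>
  have b2: "\<bar>(exp (h\<^sup>2 * s / 2) - 1) / h\<^sup>2 - m2 / 2\<bar> \<le> h * expectation G" if h: "0 < h" "h \<le> 1" for h
  proof -
    have "h\<^sup>2 * \<bar>(exp (h\<^sup>2 * s / 2) - 1) / h\<^sup>2 - m2 / 2\<bar> = \<bar>exp (h\<^sup>2 * s / 2) - 1 - h\<^sup>2 * m2 / 2\<bar>"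
    proof -
      have "h\<^sup>2 * \<bar>(exp (h\<^sup>2 * s / 2) - 1) / h\<^sup>2 - m2 / 2\<bar> = \<bar>h\<^sup>2 * ((exp (h\<^sup>2 * s / 2) - 1) / h\<^sup>2 - m2 / 2)\<bar>"
        by (simp add: abs_mult)
      then show ?thesis using h by (simp only: right_diff_distrib) simp
    qed
    also have "\<dots> \<le> h\<^sup>2 * (h * expectation G)"
      using main[OF h, of 1] m1 by (simp add: m1_def eval_nat_numeral mult_ac)
    finally show ?thesis using h by simp
  qed
  have "((\<lambda>h. \<bar>(exp (h\<^sup>2 * s / 2) - 1) / h\<^sup>2 - m2 / 2\<bar>) \<longlongrightarrow> 0) (at_right 0)"
  proof (rule tendsto_sandwich[OF _ _ tendsto_const])
    show "((\<lambda>h. h * expectation G) \<longlongrightarrow> 0) (at_right 0)" by (auto intro!: tendsto_eq_intros)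
    show "\<forall>\<^sub>F h in at_right 0. \<bar>(exp (h\<^sup>2 * s / 2) - 1) / h\<^sup>2 - m2 / 2\<bar> \<le> h * expectation G"
      using ev by eventually_elim (use b2 in auto)
  qed simp
  then have "((\<lambda>h. (exp (h\<^sup>2 * s / 2) - 1) / h\<^sup>2 - m2 / 2) \<longlongrightarrow> 0) (at_right 0)"
    by (simp add: tendsto_rabs_zero_iff)
  moreover have "((\<lambda>h. (exp (h\<^sup>2 * s / 2) - 1) / h\<^sup>2 - m2 / 2) \<longlongrightarrow> s / 2 - m2 / 2) (at_right 0)"
    by real_asymp
  ultimately have "s / 2 - m2 / 2 = 0"
    using tendsto_unique trivial_limit_at_right_real by blast
  then show "expectation (\<lambda>\<omega>. (Y \<omega>)\<^sup>2) = s" by (simp add: m2_def)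
qed

section \<open>Gaussian vectors: exponential moments, mean and covariance\<close>

lemma pos_def_matrix_inv:
  assumes "pos_def S"
  shows "matrix_inv S ** S = mat 1"
proof -
  have "x = 0" if "S *v x = 0" for x
    using assms that by (auto simp: pos_def_def)
  then obtain B where "B ** S = mat 1"
    using matrix_left_invertible_ker[of S] by blast
  then have "invertible S"
    unfolding invertible_def using matrix_left_right_inverse by blast
  then show ?thesis
    unfolding matrix_inv_def invertible_def by (metis (mono_tags, lifting) someI_ex)
qed

lemma inner_matrix_vector_mult_sym:
  fixes S :: "real^'n^'n"
  assumes "transpose S = S"
  shows "(S *v a) \<bullet> b = a \<bullet> (S *v b)"
  using assms dot_lmul_matrix[of a S b] by (metis transpose_matrix_vector)

text \<open>Completing the square: for a shift of the form \<open>S *v c\<close> the inverse matrix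
  cancels in the cross term, which becomes linear in \<open>x\<close>.\<close>

lemma gaussian_density_shift:
  assumes S: "pos_def S"
  shows "gaussian_density S (S *v c + x) = gaussian_density S x * exp (- (c \<bullet> x)) * exp (- (c \<bullet> (S *v c)) / 2)"
proof -
  let ?G = "matrix_inv S"
  have sym: "transpose S = S" using S by (simp add: pos_def_def)
  have inv: "?G *v (S *v a) = a" for a
    by (simp add: matrix_vector_mul_assoc pos_def_matrix_inv[OF S])
  have inv2: "S *v (?G *v a) = a" for a
  proof -
    have "S ** ?G = mat 1"
      using pos_def_matrix_inv[OF S] matrix_left_right_inverse by blast
    then show ?thesis by (simp add: matrix_vector_mul_assoc)
  qed
  have "(S *v c + x) \<bullet> (?G *v (S *v c + x)) = c \<bullet> (S *v c) + 2 * (c \<bullet> x) + x \<bullet> (?G *v x)"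
    by (simp add: matrix_vector_right_distrib inner_add inv inner_matrix_vector_mult_sym[OF sym] inv2 inner_commute)
  then have "- ((S *v c + x) \<bullet> (?G *v (S *v c + x))) / 2
      = - (x \<bullet> (?G *v x)) / 2 + - (c \<bullet> x) + - (c \<bullet> (S *v c)) / 2"
    by (simp add: field_simps)
  then show ?thesis
    unfolding gaussian_density_def by (simp only: exp_add times_divide_eq_left)
qed

lemma nn_integral_lborel_translation:
  fixes f :: "'a::euclidean_space \<Rightarrow> ennreal"
  assumes [measurable]: "f \<in> borel_measurable borel"
  shows "(\<integral>\<^sup>+x. f (a + x) \<partial>lborel) = (\<integral>\<^sup>+x. f x \<partial>lborel)"
proof -
  have "(\<integral>\<^sup>+x. f x \<partial>lborel) = (\<integral>\<^sup>+x. f x \<partial>distr lborel borel ((+) a))"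
    by (simp add: lborel_distr_plus)
  also have "\<dots> = (\<integral>\<^sup>+x. f (a + x) \<partial>lborel)"
    by (subst nn_integral_distr) auto
  finally show ?thesis by simp
qed

text \<open>Translating by \<open>- S c\<close> tilts the density by \<open>exp (c \<bullet> x)\<close> up to a constant, so translation invariance
  of Lebesgue measure determines this integral without evaluating the normalising constant.\<close>

lemma (in prob_space) gaussian_mgf:
  fixes X :: "'a \<Rightarrow> real^'n"
  assumes X: "distributed M lborel X (\<lambda>x. ennreal (gaussian_density S x))" and S: "pos_def S"
  shows "(\<integral>\<^sup>+\<omega>. ennreal (exp (c \<bullet> X \<omega>)) \<partial>M) = ennreal (exp (c \<bullet> (S *v c) / 2))"
proof -
  let ?g = "gaussian_density S"
  have [measurable]: "(\<lambda>x. ennreal (?g x)) \<in> borel_measurable borel"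
    using X by (simp add: distributed_def)
  have one: "(\<integral>\<^sup>+x. ennreal (?g x) \<partial>lborel) = 1"
    using distributed_nn_integral[OF X, of "\<lambda>_. 1"] by (simp add: emeasure_space_1)
  have "1 = (\<integral>\<^sup>+x. ennreal (?g (S *v (- c) + x)) \<partial>lborel)"
    using nn_integral_lborel_translation[of "\<lambda>x. ennreal (?g x)" "S *v (- c)"] one by simp
  also have "\<dots> = (\<integral>\<^sup>+x. ennreal (exp (- (c \<bullet> (S *v c)) / 2)) * (ennreal (?g x) * ennreal (exp (c \<bullet> x))) \<partial>lborel)"
  proof (rule nn_integral_cong)
    fix x
    have "?g (S *v (- c) + x) = exp (- (c \<bullet> (S *v c)) / 2) * (exp (c \<bullet> x) * ?g x)"
      unfolding gaussian_density_shift[OF S] by (simp add: matrix_vector_mult_diff_rdistrib mult_ac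
        linear_neg[OF matrix_vector_mul_linear])
    then show "ennreal (?g (S *v (- c) + x)) = ennreal (exp (- (c \<bullet> (S *v c)) / 2)) * (ennreal (?g x) * ennreal (exp (c \<bullet> x)))"
      by (simp add: ennreal_mult'' mult_ac)
  qed
  also have "\<dots> = ennreal (exp (- (c \<bullet> (S *v c)) / 2)) * (\<integral>\<^sup>+\<omega>. ennreal (exp (c \<bullet> X \<omega>)) \<partial>M)"
    by (subst nn_integral_cmult) (auto simp: distributed_nn_integral[OF X, of "\<lambda>x. ennreal (exp (c \<bullet> x))"])
  \<comment> \<open>Multiplying by the reciprocal constant isolates the integral before it is known
    to be finite.\<close>
  finally have "ennreal (exp (c \<bullet> (S *v c) / 2)) * 1 = ennreal (exp (c \<bullet> (S *v c) / 2)) *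
     (ennreal (exp (- (c \<bullet> (S *v c)) / 2)) * (\<integral>\<^sup>+\<omega>. ennreal (exp (c \<bullet> X \<omega>)) \<partial>M))"
    by simp
  then show ?thesis
    by (simp add: mult.assoc[symmetric] ennreal_mult'[symmetric] exp_add[symmetric])
qed

text \<open>Along each ray \<open>h *\<^sub>R c\<close> the vector formula is the generating
  function of a centred scalar with variance \<open>c \<bullet> (S *v c)\<close>.\<close>

lemma (in prob_space) gaussian_moments:
  fixes X :: "'a \<Rightarrow> real^'n"
  assumes X: "distributed M lborel X (\<lambda>x. ennreal (gaussian_density S x))" and S: "pos_def S"
  shows "integrable M (\<lambda>\<omega>. a \<bullet> X \<omega>)" "expectation (\<lambda>\<omega>. a \<bullet> X \<omega>) = 0"
    "has_bochner_integral M (\<lambda>\<omega>. (a \<bullet> X \<omega>) * (b \<bullet> X \<omega>)) (a \<bullet> (S *v b))"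
proof -
  have [measurable]: "X \<in> borel_measurable M"
    using X by (simp add: distributed_def)
  have mgf: "(\<integral>\<^sup>+\<omega>. ennreal (exp (h * (c \<bullet> X \<omega>))) \<partial>M) = ennreal (exp (h\<^sup>2 * (c \<bullet> (S *v c)) / 2))" for h c
    using gaussian_mgf[OF X S, of "h *\<^sub>R c"]
    by (simp add: scaleR_matrix_vector_assoc[symmetric] matrix_vector_mult_scaleR power2_eq_square mult_ac)
  note m = moments_of_gaussian_mgf[OF _ mgf, simplified]
  show "integrable M (\<lambda>\<omega>. a \<bullet> X \<omega>)" "expectation (\<lambda>\<omega>. a \<bullet> X \<omega>) = 0"
    by (rule m)+
  have q: "has_bochner_integral M (\<lambda>\<omega>. (c \<bullet> X \<omega>)\<^sup>2) (c \<bullet> (S *v c))" for c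
    using m(2,4)[of c] by (simp add: has_bochner_integral_iff)
  have sym: "b \<bullet> (S *v a) = a \<bullet> (S *v b)"
    using S inner_matrix_vector_mult_sym[of S b a] by (simp add: pos_def_def inner_commute)
  \<comment> \<open>Polarization recovers the mixed moment from the variances in the directions
    \<open>a + b\<close>, \<open>a\<close> and \<open>b\<close>.\<close>
  have "has_bochner_integral M (\<lambda>\<omega>. (((a + b) \<bullet> X \<omega>)\<^sup>2 - (a \<bullet> X \<omega>)\<^sup>2 - (b \<bullet> X \<omega>)\<^sup>2) / 2)
     (((a + b) \<bullet> (S *v (a + b)) - a \<bullet> (S *v a) - b \<bullet> (S *v b)) / 2)"
    by (intro has_bochner_integral_divide_zero has_bochner_integral_diff q)
  then show "has_bochner_integral M (\<lambda>\<omega>. (a \<bullet> X \<omega>) * (b \<bullet> X \<omega>)) (a \<bullet> (S *v b))"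
    by (simp add: inner_add power2_eq_square algebra_simps matrix_vector_right_distrib sym)
qed


section \<open>Independence of functions of independent variables\<close>

text \<open>Events of \<open>f (X \<omega>)\<close> are events of \<open>X\<close>, and likewise for
  \<open>Y\<close>, so independence passes to these subfamilies. The maps also bring both variables
  to a common value type, as \<open>indep_var\<close> demands.\<close>

lemma (in prob_space) indep_rv_imp_indep_var:
  assumes "indep_rv M S X T Y" and f: "f \<in> measurable S S'" and g: "g \<in> measurable T T'"
  shows "indep_var S' (\<lambda>\<omega>. f (X \<omega>)) T' (\<lambda>\<omega>. g (Y \<omega>))"
proof -
  have X: "X \<in> measurable M S" and Y: "Y \<in> measurable M T"
    and i: "indep_set {X -` E \<inter> space M | E. E \<in> sets S} {Y -` E \<inter> space M | E. E \<in> sets T}"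
    using assms(1) by (auto simp: indep_rv_def)
  have sub: "{(\<lambda>\<omega>. h (Z \<omega>)) -` E \<inter> space M | E. E \<in> sets N'} \<subseteq> {Z -` E \<inter> space M | E. E \<in> sets N}"
    if "h \<in> measurable N N'" "Z \<in> measurable M N"
    for h and Z :: "'a \<Rightarrow> 'x" and N and N' :: "'y measure"
  proof
    fix D assume "D \<in> {(\<lambda>\<omega>. h (Z \<omega>)) -` E \<inter> space M | E. E \<in> sets N'}"
    then obtain E where E: "E \<in> sets N'" "D = (\<lambda>\<omega>. h (Z \<omega>)) -` E \<inter> space M" by auto
    have "D = Z -` (h -` E \<inter> space N) \<inter> space M"
      using E that measurable_space[OF that(2)] by auto
    then show "D \<in> {Z -` E \<inter> space M | E. E \<in> sets N}"
      using measurable_sets[OF that(1) E(1)] by blast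
  qed
  have stable: "Int_stable {Z -` E \<inter> space M | E. E \<in> sets N}" for Z :: "'a \<Rightarrow> 'x" and N
  proof (rule Int_stableI, safe)
    fix E F assume "E \<in> sets N" "F \<in> sets N"
    then show "\<exists>G. Z -` E \<inter> space M \<inter> (Z -` F \<inter> space M) = Z -` G \<inter> space M \<and> G \<in> sets N"
      by (intro exI[of _ "E \<inter> F"]) auto
  qed
  have "indep_set {(\<lambda>\<omega>. f (X \<omega>)) -` E \<inter> space M | E. E \<in> sets S'}
                  {(\<lambda>\<omega>. g (Y \<omega>)) -` E \<inter> space M | E. E \<in> sets T'}"
    using i unfolding indep_set_def
    by (rule indep_sets_mono_sets) (use sub[OF f X] sub[OF g Y] in \<open>auto split: bool.split\<close>)
  \<comment> \<open>\<open>indep_var_eq\<close> speaks of generated sigma-algebras; closure of the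
    preimage families under intersection carries independence over to them.\<close>
  then have "indep_set (sigma_sets (space M) {(\<lambda>\<omega>. f (X \<omega>)) -` E \<inter> space M | E. E \<in> sets S'})
                  (sigma_sets (space M) {(\<lambda>\<omega>. g (Y \<omega>)) -` E \<inter> space M | E. E \<in> sets T'})"
    by (rule indep_set_sigma_sets) (fact stable)+
  then show ?thesis
    unfolding indep_var_eq using measurable_compose[OF X f] measurable_compose[OF Y g] by simp
qed

section \<open>Stacked vectors and quadratic forms\<close>

definition stack :: "'a^'r \<Rightarrow> 'a^'s \<Rightarrow> 'a^('r::finite + 's::finite)" where
  "stack a b = (\<chi> i. case i of Inl r \<Rightarrow> a $ r | Inr s \<Rightarrow> b $ s)"

lemma stack_nth [simp]: "stack a b $ Inl r = a $ r" "stack a b $ Inr s = b $ s"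
  by (simp_all add: stack_def)

lemma stack_add: "stack a b + stack c d = stack (a + c) (b + d)"
  by (auto simp: vec_eq_iff stack_def split: sum.splits)

lemma sum_UNIV_sum:
  fixes f :: "'a::finite + 'b::finite \<Rightarrow> 'c::comm_monoid_add"
  shows "(\<Sum>i\<in>UNIV. f i) = (\<Sum>i\<in>UNIV. f (Inl i)) + (\<Sum>j\<in>UNIV. f (Inr j))"
  by (simp add: sum.Plus flip: UNIV_Plus_UNIV)

lemma inner_stack: "stack a b \<bullet> stack c d = a \<bullet> c + b \<bullet> d"
  by (simp add: inner_vec_def sum_UNIV_sum)

lemma norm_stack_0: "norm (stack (a :: real^'n) (0 :: real^'m)) = norm a"
  by (simp add: norm_eq_sqrt_inner inner_stack)

lemma block4_mult_stack:
  "block4 E F G H *v stack a b = stack (E *v a + F *v b) (G *v a + H *v b)"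
  by (auto simp: vec_eq_iff stack_def block4_def matrix_vector_mult_def sum_UNIV_sum split: sum.splits)

lemma block_col_mult: "block_col E F *v a = stack (E *v a) (F *v a)"
  by (auto simp: vec_eq_iff stack_def block_col_def matrix_vector_mult_def split: sum.splits)

lemma inner_matrix_le_norm2: "a \<bullet> (X *v a) \<le> norm2 X * (norm a)\<^sup>2"
proof -
  have "a \<bullet> (X *v a) \<le> norm a * norm (X *v a)" by (rule norm_cauchy_schwarz)
  also have "\<dots> \<le> norm a * (norm2 X * norm a)"
    unfolding norm2_def by (intro mult_left_mono onorm) auto
  finally show ?thesis by (simp add: power2_eq_square mult_ac)
qed

lemma norm2_nonneg: "0 \<le> norm2 X"
  unfolding norm2_def by (rule onorm_pos_le) simp

lemma pos_def_imp_nonneg: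
  assumes "pos_def P"
  shows "0 \<le> a \<bullet> (P *v a)"
  using assms by (cases "a = 0") (auto simp: pos_def_def intro: less_imp_le)

text \<open>Young's inequality for the form \<open>P\<close>: expand it at
  \<open>c *\<^sub>R a - b\<close>, where it is nonnegative, and divide by \<open>c\<close>.\<close>

lemma quadratic_form_add_le:
  assumes P: "pos_def P" and "0 < c"
  shows "(a + b) \<bullet> (P *v (a + b)) \<le> (1 + c) * (a \<bullet> (P *v a)) + (1 + 1 / c) * (b \<bullet> (P *v b))"
proof -
  have sym: "b \<bullet> (P *v a) = a \<bullet> (P *v b)"
    using P inner_matrix_vector_mult_sym[of P b a] by (simp add: pos_def_def inner_commute)
  have "0 \<le> (c *\<^sub>R a - b) \<bullet> (P *v (c *\<^sub>R a - b))"
    by (rule pos_def_imp_nonneg[OF P])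
  also have "\<dots> = c * (c * (a \<bullet> (P *v a)) - 2 * (a \<bullet> (P *v b)) + b \<bullet> (P *v b) / c)"
    using \<open>0 < c\<close> by (simp add: matrix_vector_mult_diff_distrib matrix_vector_mult_scaleR inner_diff
        sym algebra_simps)
  finally have "0 \<le> c * (a \<bullet> (P *v a)) - 2 * (a \<bullet> (P *v b)) + b \<bullet> (P *v b) / c"
    using \<open>0 < c\<close> by (simp add: zero_le_mult_iff)
  then show ?thesis
    by (simp add: matrix_vector_right_distrib inner_add sym algebra_simps)
qed

lemma inner_congruence: "a \<bullet> ((transpose X ** P ** X) *v a) = (X *v a) \<bullet> (P *v (X *v a))"
  for a :: "real^'n"
  by (metis dot_lmul_matrix inner_commute matrix_vector_mul_assoc transpose_matrix_vector)

section \<open>Summed recursions and long-run averages\<close>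

text \<open>Summing the recursion telescopes. The induction carries the end term \<open>V T\<close>,
  which is dropped at the end by nonnegativity.\<close>

lemma contraction_sum_bound:
  fixes V c :: "nat \<Rightarrow> real"
  assumes "\<And>k. 0 \<le> V k" and step: "\<And>k. V (Suc k) \<le> r * V k + c k"
  shows "(1 - r) * (\<Sum>k<T. V k) \<le> V 0 + (\<Sum>k<T. c k)"
proof -
  have "(1 - r) * (\<Sum>k<T. V k) + V T \<le> V 0 + (\<Sum>k<T. c k)"
  proof (induction T)
    case (Suc T)
    then show ?case using step[of T] by (simp add: algebra_simps)
  qed simp
  then show ?thesis using assms(1)[of T] by linarith
qed

text \<open>The constant \<open>a\<close>, later the share of the initial state, is divided by the
  horizon and vanishes in the limit.\<close>

lemma limsup_average_le:
  fixes I :: "nat \<Rightarrow> ennreal"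
  assumes "\<And>T. I T \<le> ennreal (a + b * real T)" and "0 \<le> a" "0 \<le> b"
  shows "limsup (\<lambda>T. enn2ereal (I T) / ereal (real T)) \<le> ereal b"
proof -
  have "limsup (\<lambda>T. enn2ereal (I T) / ereal (real T)) \<le> limsup (\<lambda>T. ereal (a / real T + b))"
  proof (rule Limsup_mono, rule eventually_sequentiallyI)
    fix T :: nat assume T: "1 \<le> T"
    have "enn2ereal (I T) \<le> enn2ereal (ennreal (a + b * real T))"
      using assms(1) by (simp add: less_eq_ennreal.rep_eq)
    then have "enn2ereal (I T) \<le> ereal (a + b * real T)"
      using assms(2,3) by (simp add: enn2ereal_ennreal del: ennreal_plus)
    then have "enn2ereal (I T) / ereal (real T) \<le> ereal (a + b * real T) / ereal (real T)"
      using T by (intro ereal_divide_right_mono) auto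
    also have "\<dots> = ereal (a / real T + b)"
      using T by (simp add: field_simps)
    finally show "enn2ereal (I T) / ereal (real T) \<le> ereal (a / real T + b)" .
  qed
  also have "\<dots> = ereal b"
  proof (rule lim_imp_Limsup)
    have "(\<lambda>T. a / real T + b) \<longlonglongrightarrow> 0 + b"
      by (intro tendsto_add lim_const_over_n tendsto_const)
    then show "(\<lambda>T. ereal (a / real T + b)) \<longlonglongrightarrow> ereal b" by simp
  qed simp
  finally show ?thesis .
qed


section \<open>Mean energy of the stacked noise\<close>

text \<open>A quadratic form is linear in the products of coordinates, so its mean is the trace of
  the second-moment matrix times \<open>P\<close>. The off-diagonal blocks vanish because the two
  noises are independent and centred.\<close>

lemma (in prob_space) stacked_noise_energy:
  fixes X :: "'a \<Rightarrow> real^'n" and Y :: "'a \<Rightarrow> real^'p" and L :: "real^'p^'m" and P :: "real^('n + 'm)^('n + 'm)"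
  assumes X: "distributed M lborel X (\<lambda>x. ennreal (gaussian_density S x))" and S: "pos_def S"
    and Y: "distributed M lborel Y (\<lambda>x. ennreal (gaussian_density V x))" and V: "pos_def V"
    and indep: "\<And>a b. indep_var borel (\<lambda>\<omega>. a \<bullet> X \<omega>) borel (\<lambda>\<omega>. b \<bullet> Y \<omega>)"
    and P: "transpose P = P"
  shows "has_bochner_integral M (\<lambda>\<omega>. stack (X \<omega>) (L *v Y \<omega>) \<bullet> (P *v stack (X \<omega>) (L *v Y \<omega>)))
    (trace (block4 S 0 0 (L ** V ** transpose L) ** P))"
proof -
  let ?e = "\<lambda>\<omega>. stack (X \<omega>) (L *v Y \<omega>)"
  let ?\<Sigma> = "block4 S 0 0 (L ** V ** transpose L)"
  note mX = gaussian_moments[OF X S] and mY = gaussian_moments[OF Y V]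
  have cross: "has_bochner_integral M (\<lambda>\<omega>. (a \<bullet> X \<omega>) * (b \<bullet> Y \<omega>)) 0" for a b
    using indep_var_integrable[OF indep mX(1) mY(1)] indep_var_lebesgue_integral[OF indep mX(1) mY(1)]
    by (simp add: has_bochner_integral_iff mX(2))
  have Xr: "X \<omega> $ r = axis r 1 \<bullet> X \<omega>" for \<omega> r
    by (simp add: inner_axis')
  \<comment> \<open>Coordinates of \<open>L *v Y \<omega>\<close> are projections of
    \<open>Y\<close> onto rows of \<open>L\<close>, so the scalar moment formulas apply to
    them.\<close>
  have Ys: "(L *v Y \<omega>) $ s = (L $ s) \<bullet> Y \<omega>" for \<omega> s
    by (simp add: matrix_vector_mult_def inner_vec_def)
  have cov: "has_bochner_integral M (\<lambda>\<omega>. ?e \<omega> $ i * ?e \<omega> $ j) (?\<Sigma> $ i $ j)" for i j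
  proof (cases i; cases j)
    fix r s assume "i = Inl r" "j = Inl s"
    then show ?thesis using mX(3)[of "axis r 1" "axis s 1"]
      by (simp add: Xr[symmetric] block4_def inner_axis' matrix_vector_mult_basis column_def)
  next
    fix r s assume "i = Inl r" "j = Inr s"
    then show ?thesis using cross[of "axis r 1" "L $ s"]
      by (simp add: Xr[symmetric] Ys block4_def)
  next
    fix r s assume "i = Inr r" "j = Inl s"
    then show ?thesis using cross[of "axis s 1" "L $ r"]
      by (simp add: Xr[symmetric] Ys block4_def mult.commute)
  next
    fix r s assume ij: "i = Inr r" "j = Inr s"
    have "L $ r \<bullet> (V *v (L $ s)) = (L ** V ** transpose L) $ r $ s"
      unfolding inner_vec_def matrix_vector_mult_def matrix_matrix_mult_def transpose_def
      by (simp add: sum_distrib_left sum_distrib_right mult_ac)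
         (rule sum.swap)
    then show ?thesis using mY(3)[of "L $ r" "L $ s"] ij
      by (simp add: Ys block4_def)
  qed
  have "has_bochner_integral M (\<lambda>\<omega>. \<Sum>i\<in>UNIV. \<Sum>j\<in>UNIV. P $ i $ j * (?e \<omega> $ i * ?e \<omega> $ j))
     (\<Sum>i\<in>UNIV. \<Sum>j\<in>UNIV. P $ i $ j * ?\<Sigma> $ i $ j)"
    by (intro has_bochner_integral_sum has_bochner_integral_mult_right cov)
  moreover have "(\<Sum>i\<in>UNIV. \<Sum>j\<in>UNIV. P $ i $ j * ?\<Sigma> $ i $ j) = trace (?\<Sigma> ** P)"
  proof -
    \<comment> \<open>The trace pairs entry \<open>(i, j)\<close> of the covariance with entry
      \<open>(j, i)\<close> of \<open>P\<close>; symmetry aligns the indices.\<close>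
    have "P $ i $ j = P $ j $ i" for i j
    proof -
      have "transpose P $ i $ j = P $ j $ i" by (simp add: transpose_def)
      then show ?thesis by (simp only: P)
    qed
    then show ?thesis by (simp add: trace_def matrix_matrix_mult_def mult.commute)
  qed
  moreover have "(\<Sum>i\<in>UNIV. \<Sum>j\<in>UNIV. P $ i $ j * (?e \<omega> $ i * ?e \<omega> $ j)) = ?e \<omega> \<bullet> (P *v ?e \<omega>)" for \<omega>
    by (simp add: inner_vec_def matrix_vector_mult_def sum_distrib_left mult_ac)
  ultimately show ?thesis by simp
qed

section \<open>Lyapunov bound along a single sample path\<close>

text \<open>A deterministic statement: the noises are arbitrary sequences, and the switching rule
  appears as a uniform bound on the deviation of \<open>u\<close> from the fallback input.\<close>

lemma switched_cost_pathwise_bound: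
  fixes A :: "real^'n^'n" and B :: "real^'m^'n" and C :: "real^'n^'p"
    and Q :: "real^'n^'n" and R :: "real^'m^'m"
    and A0 :: "real^'n0^'n0" and B0 :: "real^'m^'n0" and L0 :: "real^'p^'n0" and K0 :: "real^'n0^'m"
    and P AA :: "real^('n + 'n0)^('n + 'n0)"
  assumes R: "pos_def R" and Q: "pos_def Q" and P: "pos_def P"
    and x: "\<And>k. x (Suc k) = A *v x k + B *v u k + w k"
    and z: "\<And>k. z (Suc k) = A0 *v z k + B0 *v u k + L0 *v (C *v x k + v k)"
    and u: "\<And>k. norm (u k - K0 *v z k) \<le> M"
    and AA: "AA = block4 A (B ** K0) (L0 ** C) (A0 + B0 ** K0)"
    and lyap: "transpose AA ** P ** AA - P + block4 Q 0 0 (transpose K0 ** R ** K0 + mat 1) = 0"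
    and \<rho>: "0 < \<rho>" "\<rho> < 1" and less: "mat_less (transpose AA ** P ** AA) (\<rho> *\<^sub>R P)"
  shows "(\<Sum>k<T. x k \<bullet> (Q *v x k) + u k \<bullet> (R *v u k))
    \<le> 4 / (1 - \<rho>) * (stack (x 0) (z 0) \<bullet> (P *v stack (x 0) (z 0)) + (\<Sum>k<T. 2 * (1 + \<rho>) / (1 - \<rho>) *
          ((norm2 (block_col B B0))\<^sup>2 * norm2 P * M\<^sup>2
           + stack (w k) (L0 *v v k) \<bullet> (P *v stack (w k) (L0 *v v k)))))
      + 2 * norm2 R * M\<^sup>2 * real T"
proof -
  define q where "q a = a \<bullet> (P *v a)" for a
  define s where "s k = stack (x k) (z k)" for k
  define d where "d k = u k - K0 *v z k" for k
  define e where "e k = stack (w k) (L0 *v v k)" for k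
  define b where "b = (norm2 (block_col B B0))\<^sup>2 * norm2 P * M\<^sup>2"
  have M0: "0 \<le> M" using u[of 0] norm_ge_zero order_trans by blast
  have d2: "(norm (d k))\<^sup>2 \<le> M\<^sup>2" for k
    using u[of k] by (simp add: d_def power_mono)
  have q0: "0 \<le> q a" for a
    unfolding q_def by (rule pos_def_imp_nonneg[OF P])
  \<comment> \<open>Writing \<open>u k\<close> as \<open>K0 *v z k + d k\<close> closes the fallback
    loop, and the deviation enters plant and fallback state alike.\<close>
  have sSuc: "s (Suc k) = AA *v s k + (block_col B B0 *v d k + e k)" for k
    by (simp add: s_def e_def d_def AA x z block4_mult_stack block_col_mult stack_add
        matrix_vector_mul_assoc[symmetric] matrix_vector_right_distrib matrix_vector_mult_add_rdistrib
        matrix_vector_mult_diff_distrib algebra_simps)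
  have qAA: "q (AA *v a) \<le> \<rho> * q a" for a
  proof -
    have "0 \<le> a \<bullet> ((\<rho> *\<^sub>R P - transpose AA ** P ** AA) *v a)"
      using less unfolding mat_less_def by (rule pos_def_imp_nonneg)
    then show ?thesis
      by (simp add: matrix_vector_mult_diff_rdistrib inner_diff inner_congruence q_def
          scaleR_matrix_vector_assoc[symmetric])
  qed
  have qB: "q (block_col B B0 *v d k) \<le> b" for k
  proof -
    have "norm (block_col B B0 *v d k) \<le> norm2 (block_col B B0) * norm (d k)"
      unfolding norm2_def by (rule onorm) simp
    then have "(norm (block_col B B0 *v d k))\<^sup>2 \<le> (norm2 (block_col B B0))\<^sup>2 * (norm (d k))\<^sup>2"
      by (metis norm_ge_zero power_mono power_mult_distrib)
    also have "\<dots> \<le> (norm2 (block_col B B0))\<^sup>2 * M\<^sup>2"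
      by (intro mult_left_mono d2) simp
    finally have "norm2 P * (norm (block_col B B0 *v d k))\<^sup>2 \<le> norm2 P * ((norm2 (block_col B B0))\<^sup>2 * M\<^sup>2)"
      by (intro mult_left_mono norm2_nonneg)
    then show ?thesis
      using inner_matrix_le_norm2[of "block_col B B0 *v d k" P] by (simp add: q_def b_def mult_ac)
  qed
  have step: "q (s (Suc k)) \<le> (1 + \<rho>) / 2 * q (s k) + 2 * (1 + \<rho>) / (1 - \<rho>) * (b + q (e k))" for k
  proof -
    \<comment> \<open>This weight raises the contraction factor from \<open>\<rho>\<close> to the
      midpoint \<open>(1 + \<rho>) / 2\<close> between \<open>\<rho>\<close> and 1.\<close>
    define c where "c = (1 - \<rho>) / (2 * \<rho>)"
    have c: "0 < c" "(1 + c) * \<rho> = (1 + \<rho>) / 2" "1 + 1 / c = (1 + \<rho>) / (1 - \<rho>)"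
      using \<rho> by (simp_all add: c_def field_simps)
    \<comment> \<open>Weight 1 in Young's inequality separates deviation from noise at the price of
      a factor 2.\<close>
    have "q (block_col B B0 *v d k + e k) \<le> 2 * (b + q (e k))"
      using quadratic_form_add_le[OF P zero_less_one, of "block_col B B0 *v d k" "e k"] qB[of k]
      by (simp add: q_def)
    then have "(1 + 1 / c) * q (block_col B B0 *v d k + e k) \<le> (1 + 1 / c) * (2 * (b + q (e k)))"
      using c(1) by (intro mult_left_mono) auto
    moreover have "(1 + c) * q (AA *v s k) \<le> (1 + c) * (\<rho> * q (s k))"
      using c(1) by (intro mult_left_mono qAA) auto
    moreover have "q (s (Suc k)) \<le> (1 + c) * q (AA *v s k) + (1 + 1 / c) * q (block_col B B0 *v d k + e k)"
      unfolding sSuc q_def by (rule quadratic_form_add_le[OF P c(1)])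
    moreover have "(1 + c) * (\<rho> * q (s k)) = (1 + \<rho>) / 2 * q (s k)"
      by (simp only: mult.assoc[symmetric] c(2))
    moreover have "(1 + 1 / c) * (2 * (b + q (e k))) = 2 * (1 + \<rho>) / (1 - \<rho>) * (b + q (e k))"
      unfolding c(3) using \<rho> by (simp add: field_simps)
    ultimately show ?thesis by linarith
  qed
  have cost: "x k \<bullet> (Q *v x k) + u k \<bullet> (R *v u k) \<le> 2 * q (s k) + 2 * norm2 R * M\<^sup>2" for k
  proof -
    \<comment> \<open>Read as a formula for \<open>P\<close>, the Lyapunov equation splits
      \<open>q (s k)\<close> into the form at \<open>AA *v s k\<close>, the stage cost under the
      fallback input, and \<open>z k \<bullet> z k\<close>; the first and last are nonnegative and
      are discarded.\<close>
    have "P = transpose AA ** P ** AA + block4 Q 0 0 (transpose K0 ** R ** K0 + mat 1)"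
      using lyap by (simp add: algebra_simps)
    then have "q (s k) = s k \<bullet> ((transpose AA ** P ** AA + block4 Q 0 0 (transpose K0 ** R ** K0 + mat 1)) *v s k)"
      unfolding q_def by (metis (no_types))
    also have "\<dots> = q (AA *v s k) + (x k \<bullet> (Q *v x k) + (K0 *v z k) \<bullet> (R *v (K0 *v z k)) + z k \<bullet> z k)"
      by (simp add: matrix_vector_mult_add_rdistrib inner_add inner_congruence q_def s_def
          block4_mult_stack inner_stack)
    finally have "x k \<bullet> (Q *v x k) + (K0 *v z k) \<bullet> (R *v (K0 *v z k)) \<le> q (s k)"
      using q0[of "AA *v s k"] inner_ge_zero[of "z k"] by linarith
    moreover have "u k \<bullet> (R *v u k) \<le> 2 * ((K0 *v z k) \<bullet> (R *v (K0 *v z k))) + 2 * (d k \<bullet> (R *v d k))"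
      using quadratic_form_add_le[OF R zero_less_one, of "K0 *v z k" "d k"] by (simp add: d_def)
    moreover have "d k \<bullet> (R *v d k) \<le> norm2 R * M\<^sup>2"
      using inner_matrix_le_norm2[of "d k" R] mult_left_mono[OF d2[of k] norm2_nonneg[of R]] by linarith
    \<comment> \<open>The input cost was doubled to separate \<open>d k\<close>; nonnegativity lets
      the state cost be doubled too, so that \<open>2 * q (s k)\<close> covers both.\<close>
    moreover have "0 \<le> x k \<bullet> (Q *v x k)" by (rule pos_def_imp_nonneg[OF Q])
    ultimately show ?thesis by linarith
  qed
  have "(\<Sum>k<T. x k \<bullet> (Q *v x k) + u k \<bullet> (R *v u k)) \<le> (\<Sum>k<T. 2 * q (s k) + 2 * norm2 R * M\<^sup>2)"
    by (rule sum_mono) (rule cost)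
  also have "\<dots> = 2 * (\<Sum>k<T. q (s k)) + 2 * norm2 R * M\<^sup>2 * real T"
    by (simp add: sum.distrib sum_distrib_left)
  finally have 1: "(\<Sum>k<T. x k \<bullet> (Q *v x k) + u k \<bullet> (R *v u k)) \<le> 2 * (\<Sum>k<T. q (s k)) + 2 * norm2 R * M\<^sup>2 * real T" .
  have "(1 - (1 + \<rho>) / 2) * (\<Sum>k<T. q (s k)) \<le> q (s 0) + (\<Sum>k<T. 2 * (1 + \<rho>) / (1 - \<rho>) * (b + q (e k)))"
    by (rule contraction_sum_bound) (use q0 step in auto)
  \<comment> \<open>The factor is 2 from the stage-cost bound times \<open>2 / (1 - \<rho>)\<close>,
    the inverse of \<open>1 - (1 + \<rho>) / 2\<close>.\<close>
  then have "4 / (1 - \<rho>) * ((1 - (1 + \<rho>) / 2) * (\<Sum>k<T. q (s k)))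
      \<le> 4 / (1 - \<rho>) * (q (s 0) + (\<Sum>k<T. 2 * (1 + \<rho>) / (1 - \<rho>) * (b + q (e k))))"
    using \<rho> by (intro mult_left_mono) auto
  also have "4 / (1 - \<rho>) * ((1 - (1 + \<rho>) / 2) * (\<Sum>k<T. q (s k))) = 2 * (\<Sum>k<T. q (s k))"
    using \<rho> by (simp add: field_simps)
  finally show ?thesis
    using 1 unfolding q_def s_def e_def b_def by linarith
qed

section \<open>Expectation and time average under the switching strategy\<close>

theorem theorem4:
  fixes Pr :: "'a measure"
    and A :: "real^'n^'n" and B :: "real^'m^'n" and C :: "real^'n^'p"
    and W :: "real^'n^'n" and V :: "real^'p^'p"
    and Q :: "real^'n^'n" and R :: "real^'m^'m"
    and A1 :: "real^'n1^'n1" and B1 :: "real^'m^'n1" and L1 :: "real^'p^'n1" and K1 :: "real^'n1^'m"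
    and A0 :: "real^'n0^'n0" and B0 :: "real^'m^'n0" and L0 :: "real^'p^'n0" and K0 :: "real^'n0^'m"
    and P0 AA0 :: "real^('n + 'n0)^('n + 'n0)"
    and \<rho>0 M :: real and t :: nat
    and w x :: "nat \<Rightarrow> 'a \<Rightarrow> real^'n" and v y :: "nat \<Rightarrow> 'a \<Rightarrow> real^'p"
    and u u0 u1 :: "nat \<Rightarrow> 'a \<Rightarrow> real^'m"
    and z1 :: "nat \<Rightarrow> 'a \<Rightarrow> real^'n1" and z0 :: "nat \<Rightarrow> 'a \<Rightarrow> real^'n0"
    and \<xi> \<eta> :: "nat \<Rightarrow> 'a \<Rightarrow> nat"
  assumes "prob_space Pr"
    and "pos_def W" and "pos_def V" and "pos_def Q" and "pos_def R"
    and "controllable A B" and "observable A C"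
    and "iid_gaussian Pr w W" and "iid_gaussian Pr v V"
    and "indep_rv Pr
           (\<Pi>\<^sub>M k\<in>UNIV. borel) (\<lambda>\<omega> k. w k \<omega>) (\<Pi>\<^sub>M k\<in>UNIV. borel) (\<lambda>\<omega> k. v k \<omega>)"
    and "indep_rv Pr
           borel (x 0) ((\<Pi>\<^sub>M k\<in>UNIV. borel) \<Otimes>\<^sub>M (\<Pi>\<^sub>M k\<in>UNIV. borel)) (\<lambda>\<omega>. (\<lambda>k. w k \<omega>, \<lambda>k. v k \<omega>))"
    and "integrable Pr (\<lambda>\<omega>. (norm (x 0 \<omega>))\<^sup>2)"
    and "\<And>k \<omega>. \<omega> \<in> space Pr \<Longrightarrow> x (Suc k) \<omega> = A *v x k \<omega> + B *v u k \<omega> + w k \<omega>"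
    and "\<And>k \<omega>. \<omega> \<in> space Pr \<Longrightarrow> y k \<omega> = C *v x k \<omega> + v k \<omega>"
    and "\<And>\<omega>. \<omega> \<in> space Pr \<Longrightarrow> z1 0 \<omega> = 0"
    and "\<And>\<omega>. \<omega> \<in> space Pr \<Longrightarrow> z0 0 \<omega> = 0"
    and "\<And>k \<omega>. \<omega> \<in> space Pr \<Longrightarrow> z1 (Suc k) \<omega> = A1 *v z1 k \<omega> + B1 *v u k \<omega> + L1 *v y k \<omega>"
    and "\<And>k \<omega>. \<omega> \<in> space Pr \<Longrightarrow> z0 (Suc k) \<omega> = A0 *v z0 k \<omega> + B0 *v u k \<omega> + L0 *v y k \<omega>"
    and "\<And>k \<omega>. \<omega> \<in> space Pr \<Longrightarrow> u1 k \<omega> = K1 *v z1 k \<omega>"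
    and "\<And>k \<omega>. \<omega> \<in> space Pr \<Longrightarrow> u0 k \<omega> = K0 *v z0 k \<omega>"
    (* \<eta> k is the value of the counter at time k after a possible reset *)
    and "M > 0" and "t \<ge> 1"
    and "\<And>\<omega>. \<omega> \<in> space Pr \<Longrightarrow> \<xi> 0 \<omega> = 0"
    and "\<And>k \<omega>. \<omega> \<in> space Pr \<Longrightarrow>
           \<eta> k \<omega> = (if \<xi> k \<omega> = 0 \<and> norm (u1 k \<omega> - u0 k \<omega>) \<ge> M then t else \<xi> k \<omega>)"
    and "\<And>k \<omega>. \<omega> \<in> space Pr \<Longrightarrow> u k \<omega> = (if \<eta> k \<omega> > 0 then u0 k \<omega> else u1 k \<omega>)"
    and "\<And>k \<omega>. \<omega> \<in> space Pr \<Longrightarrow> int (\<xi> (Suc k) \<omega>) = max (int (\<eta> k \<omega>) - 1) 0"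
    and "AA0 = block4 A (B ** K0) (L0 ** C) (A0 + B0 ** K0)"
    and "stable AA0" and "stable A0"
    and "pos_def P0"
    and "transpose AA0 ** P0 ** AA0 - P0 + block4 Q 0 0 (transpose K0 ** R ** K0 + mat 1) = 0"
    and "0 < \<rho>0" and "\<rho>0 < 1"
    and "mat_less (transpose AA0 ** P0 ** AA0) (\<rho>0 *\<^sub>R P0)"
  shows "lq_cost Pr Q R x u \<le> ereal (
           (8 * (1 + \<rho>0) * (norm2 (block_col B B0))\<^sup>2 * norm2 P0 / (1 - \<rho>0)\<^sup>2 + 2 * norm2 R) * M\<^sup>2
           + 8 * (1 + \<rho>0) * trace (block4 W 0 0 (L0 ** V ** transpose L0) ** P0) / (1 - \<rho>0)\<^sup>2)"
proof -
  interpret prob_space Pr by fact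
  define q where "q a = a \<bullet> (P0 *v a)" for a
  define e where "e k \<omega> = stack (w k \<omega>) (L0 *v v k \<omega>)" for k \<omega>
  define \<tau> where "\<tau> = trace (block4 W 0 0 (L0 ** V ** transpose L0) ** P0)"
  define b where "b = (norm2 (block_col B B0))\<^sup>2 * norm2 P0 * M\<^sup>2"
  define g where "g = 2 * (1 + \<rho>0) / (1 - \<rho>0)"
  define a where "a = 4 / (1 - \<rho>0) * (norm2 P0 * expectation (\<lambda>\<omega>. (norm (x 0 \<omega>))\<^sup>2))"
  \<comment> \<open>A majorant of the accumulated cost that depends on the sample only through the
    initial state and the noises, so its mean is explicit.\<close>
  define F where "F T \<omega> = 4 / (1 - \<rho>0) * (norm2 P0 * (norm (x 0 \<omega>))\<^sup>2
      + (\<Sum>k<T. g * (b + q (e k \<omega>)))) + 2 * norm2 R * M\<^sup>2 * real T" for T \<omega>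
  have q0: "0 \<le> q a" for a
    unfolding q_def by (rule pos_def_imp_nonneg) fact
  have b0: "0 \<le> b" by (simp add: b_def norm2_nonneg)
  have g0: "0 \<le> g" using \<open>0 < \<rho>0\<close> \<open>\<rho>0 < 1\<close> by (simp add: g_def)
  have F0: "0 \<le> F T \<omega>" for T \<omega>
    unfolding F_def using \<open>\<rho>0 < 1\<close> b0 g0
    by (intro add_nonneg_nonneg mult_nonneg_nonneg sum_nonneg) (auto simp: norm2_nonneg q0)
  have energy: "has_bochner_integral Pr (\<lambda>\<omega>. q (e k \<omega>)) \<tau>" for k
    unfolding q_def e_def \<tau>_def
  proof (rule stacked_noise_energy)
    show "distributed Pr lborel (w k) (\<lambda>x. ennreal (gaussian_density W x))"
      "distributed Pr lborel (v k) (\<lambda>x. ennreal (gaussian_density V x))"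
      using \<open>iid_gaussian Pr w W\<close> \<open>iid_gaussian Pr v V\<close> by (auto simp: iid_gaussian_def)
    show "indep_var borel (\<lambda>\<omega>. c \<bullet> w k \<omega>) borel (\<lambda>\<omega>. c' \<bullet> v k \<omega>)" for c c'
      using indep_rv_imp_indep_var[OF \<open>indep_rv Pr (\<Pi>\<^sub>M k\<in>UNIV. borel) (\<lambda>\<omega> k. w k \<omega>) _ _\<close>,
          of "\<lambda>f. c \<bullet> f k" borel "\<lambda>f. c' \<bullet> f k" borel]
      by simp
    show "transpose P0 = P0" using \<open>pos_def P0\<close> by (simp add: pos_def_def)
  qed fact+
  \<comment> \<open>The trace is nonnegative because it is the mean of a nonnegative form.\<close>
  have "0 \<le> expectation (\<lambda>\<omega>. q (e 0 \<omega>))"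
    by (intro Bochner_Integration.integral_nonneg q0)
  then have "0 \<le> \<tau>"
    using energy[of 0] by (simp add: has_bochner_integral_iff)
  have bound: "(\<Sum>k<T. x k \<omega> \<bullet> (Q *v x k \<omega>) + u k \<omega> \<bullet> (R *v u k \<omega>)) \<le> F T \<omega>"
    if \<omega>: "\<omega> \<in> space Pr" for T \<omega>
  proof -
    \<comment> \<open>If \<open>\<eta> k \<omega>\<close> is positive, the input is
      \<open>u0\<close> and the deviation is zero. Otherwise no reset took place, since
      \<open>t \<ge> 1\<close> would have made the counter positive; hence
      \<open>\<xi> k \<omega>\<close> is 0 and the threshold test failed, giving a deviation below
      \<open>M\<close>.\<close>
    have du: "norm (u k \<omega> - K0 *v z0 k \<omega>) \<le> M" for k
      using assms(20)[OF \<omega>, of k] assms(24)[OF \<omega>, of k] assms(25)[OF \<omega>, of k] \<open>M > 0\<close> \<open>t \<ge> 1\<close>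
      by (auto split: if_splits)
    have "(\<Sum>k<T. x k \<omega> \<bullet> (Q *v x k \<omega>) + u k \<omega> \<bullet> (R *v u k \<omega>))
      \<le> 4 / (1 - \<rho>0) * (stack (x 0 \<omega>) (z0 0 \<omega>) \<bullet> (P0 *v stack (x 0 \<omega>) (z0 0 \<omega>)) + (\<Sum>k<T. g * (b + q (e k \<omega>))))
        + 2 * norm2 R * M\<^sup>2 * real T"
      unfolding g_def b_def q_def e_def
      using assms(13,14,18)[OF \<omega>] du
      by (intro switched_cost_pathwise_bound[OF assms(5,4,30) _ _ _ assms(27,31-34)]) simp_all
    \<comment> \<open>The fallback state starts at 0, so the stacked initial state has the norm of
      \<open>x 0 \<omega>\<close>.\<close>
    moreover have "4 / (1 - \<rho>0) * (stack (x 0 \<omega>) (z0 0 \<omega>) \<bullet> (P0 *v stack (x 0 \<omega>) (z0 0 \<omega>)))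
        \<le> 4 / (1 - \<rho>0) * (norm2 P0 * (norm (x 0 \<omega>))\<^sup>2)"
      using inner_matrix_le_norm2[of "stack (x 0 \<omega>) (z0 0 \<omega>)" P0] assms(16)[OF \<omega>] \<open>\<rho>0 < 1\<close>
      by (intro mult_left_mono) (simp_all add: norm_stack_0)
    ultimately show ?thesis
      unfolding F_def by (simp only: distrib_left)
  qed
  have EF: "has_bochner_integral Pr (F T) (a + (4 / (1 - \<rho>0) * g * (b + \<tau>) + 2 * norm2 R * M\<^sup>2) * real T)" for T
  proof -
    have "has_bochner_integral Pr (\<lambda>\<omega>. (norm (x 0 \<omega>))\<^sup>2) (expectation (\<lambda>\<omega>. (norm (x 0 \<omega>))\<^sup>2))"
      using assms(12) by (simp add: has_bochner_integral_iff)
    moreover have "has_bochner_integral Pr (\<lambda>_. c) c" for c :: real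
      by (simp add: has_bochner_integral_iff prob_space)
    ultimately have "has_bochner_integral Pr (F T) (4 / (1 - \<rho>0) *
        (norm2 P0 * expectation (\<lambda>\<omega>. (norm (x 0 \<omega>))\<^sup>2) + (\<Sum>k<T. g * (b + \<tau>))) + 2 * norm2 R * M\<^sup>2 * real T)"
      unfolding F_def
      by (intro has_bochner_integral_add has_bochner_integral_mult_right has_bochner_integral_sum energy) auto
    then show ?thesis
      by (simp add: a_def distrib_left distrib_right ac_simps add_divide_distrib)
  qed
  have "lq_cost Pr Q R x u \<le> ereal (4 / (1 - \<rho>0) * g * (b + \<tau>) + 2 * norm2 R * M\<^sup>2)"
    unfolding lq_cost_def
  proof (rule limsup_average_le[where a = a])
    fix T
    \<comment> \<open>Monotonicity of the nonnegative integral holds without measurability of the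
      integrands, so the pointwise bound transfers directly to the expected cost.\<close>
    have "(\<integral>\<^sup>+\<omega>. ennreal (\<Sum>k<T. x k \<omega> \<bullet> (Q *v x k \<omega>) + u k \<omega> \<bullet> (R *v u k \<omega>)) \<partial>Pr) \<le> (\<integral>\<^sup>+\<omega>. ennreal (F T \<omega>) \<partial>Pr)"
      by (intro nn_integral_mono ennreal_leI bound)
    also have "\<dots> = ennreal (a + (4 / (1 - \<rho>0) * g * (b + \<tau>) + 2 * norm2 R * M\<^sup>2) * real T)"
      using EF[of T] F0 by (simp add: nn_integral_eq_integral has_bochner_integral_iff)
    finally show "(\<integral>\<^sup>+\<omega>. ennreal (\<Sum>k<T. x k \<omega> \<bullet> (Q *v x k \<omega>) + u k \<omega> \<bullet> (R *v u k \<omega>)) \<partial>Pr)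
      \<le> ennreal (a + (4 / (1 - \<rho>0) * g * (b + \<tau>) + 2 * norm2 R * M\<^sup>2) * real T)" .
    show "0 \<le> a" "0 \<le> 4 / (1 - \<rho>0) * g * (b + \<tau>) + 2 * norm2 R * M\<^sup>2"
      using \<open>\<rho>0 < 1\<close> g0 b0 \<open>0 \<le> \<tau>\<close> by (simp_all add: a_def norm2_nonneg)
  qed
  \<comment> \<open>The factor 8 and the squared denominator combine the summed contraction with the
    gain \<open>g\<close> of a single step.\<close>
  also have "4 / (1 - \<rho>0) * g = 8 * (1 + \<rho>0) / (1 - \<rho>0)\<^sup>2"
    by (simp add: g_def power2_eq_square)
  also have "8 * (1 + \<rho>0) / (1 - \<rho>0)\<^sup>2 * (b + \<tau>) + 2 * norm2 R * M\<^sup>2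
      = (8 * (1 + \<rho>0) * (norm2 (block_col B B0))\<^sup>2 * norm2 P0 / (1 - \<rho>0)\<^sup>2 + 2 * norm2 R) * M\<^sup>2
        + 8 * (1 + \<rho>0) * \<tau> / (1 - \<rho>0)\<^sup>2"
    by (simp add: b_def ring_distribs mult_ac add_divide_distrib[symmetric])
  finally show ?thesis unfolding \<tau>_def .
qed

end
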